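(* Let $G=N\rtimes H$ be a semidirect product of groups. If $G$ has every finite group as an upper section, then $N$ has every finite group as an upper section or $H$ has every finite group as an upper section.
   Context: A group $G$ has every finite group as an upper section if for every finite group $F$ there is a finite index subgroup of $G$ which admits a surjective homomorphism onto $F$. In $N\rtimes H$ the normal factor is $N$. *)

theory Defs
  imports "HOL-Algebra.Algebra"
begin

definition upper_section :: "('a, 'c) monoid_scheme \<Rightarrow> ('b, 'd) monoid_scheme \<Rightarrow> bool" where
  "upper_section G F \<longleftrightarrow>
     (\<exists>K. subgroup K G \<and> finite (rcosets\<^bsub>G\<^esub> K) \<and> (\<exists>f. f \<in> epi (G\<lparr>carrier := K\<rparr>) F))"

text \<open>
  The bound variable \<open>F\<close> must have a fixed type. Carriers in \<^typ>\<open>nat\<close> suffice, since every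
  finite group is isomorphic to one whose carrier is a set of natural numbers;
  \<open>every_finite_upper_sectionD\<close> below recovers the property for finite groups of arbitrary type.
\<close>

definition every_finite_upper_section :: "('a, 'c) monoid_scheme \<Rightarrow> bool" where
  "every_finite_upper_section G \<longleftrightarrow>
     (\<forall>F :: nat monoid. group F \<and> finite (carrier F) \<longrightarrow> upper_section G F)"

text \<open>
  The internal semidirect product \<open>G = N \<rtimes> H\<close> with normal factor \<open>N\<close>; an external semidirect
  product is the internal one of the canonical copies of its two factors.
\<close>

definition semidirect_product :: "('a, 'c) monoid_scheme \<Rightarrow> 'a set \<Rightarrow> 'a set \<Rightarrow> bool" where
  "semidirect_product G N H \<longleftrightarrow>
     N \<lhd> G \<and> subgroup H G \<and> N \<inter> H = {\<one>\<^bsub>G\<^esub>} \<and> N <#>\<^bsub>G\<^esub> H = carrier G"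

lemma every_finite_upper_sectionD:
  fixes F :: "('b, 'd) monoid_scheme"
  assumes G: "every_finite_upper_section G" and F: "group F" "finite (carrier F)"
  shows "upper_section G F"
proof -
  obtain e :: "'b \<Rightarrow> nat" where e: "inj_on e (carrier F)"
    using F(2) finite_imp_inj_to_nat_seg by blast
  define d where "d = inv_into (carrier F) e"
  have d: "d (e x) = x" if "x \<in> carrier F" for x
    using that e by (simp add: d_def)
  define F' :: "nat monoid" where
    "F' = \<lparr>carrier = e ` carrier F, monoid.mult = (\<lambda>x y. e (d x \<otimes>\<^bsub>F\<^esub> d y)), one = e \<one>\<^bsub>F\<^esub>\<rparr>"
  interpret F: group F by fact
  have grp: "group F'"
  proof (rule groupI)
    show "\<exists>y\<in>carrier F'. y \<otimes>\<^bsub>F'\<^esub> x = \<one>\<^bsub>F'\<^esub>" if x: "x \<in> carrier F'" for x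
    proof -
      obtain a where a: "a \<in> carrier F" "x = e a"
        using x by (auto simp: F'_def)
      then show ?thesis
        by (intro bexI[of _ "e (inv\<^bsub>F\<^esub> a)"]) (auto simp: F'_def d)
    qed
  qed (auto simp: F'_def d F.m_assoc)
  have "finite (carrier F')"
    using F(2) by (simp add: F'_def)
  with G grp obtain K f where K: "subgroup K G" "finite (rcosets\<^bsub>G\<^esub> K)"
    and f: "f \<in> epi (G\<lparr>carrier := K\<rparr>) F'"
    unfolding every_finite_upper_section_def upper_section_def by blast
  have "d \<in> hom F' F" "d ` carrier F' = carrier F"
    by (auto simp: hom_def F'_def d image_image)
  then have "d \<circ> f \<in> epi (G\<lparr>carrier := K\<rparr>) F"
    using f unfolding epi_def mem_Collect_eq by (metis hom_compose image_comp)
  with K show ?thesis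
    unfolding upper_section_def by blast
qed

end

theory Submission
  imports Defs
begin

text \<open>
  Suppose that \<open>A\<close> and \<open>B\<close> are finite groups, and let \<open>f\<close> map a finite index subgroup \<open>K\<close> of \<open>G\<close>
  onto the regular wreath product of \<open>A\<close> by \<open>B\<close>. Put \<open>M = f (K \<inter> N)\<close>, a normal subgroup of
  the wreath product. If \<open>M\<close> contains some \<open>b \<noteq> \<one>\<close> of the top group \<open>B\<close>, then it contains the
  commutators of \<open>b\<close> with the base group, and already those with functions supported at \<open>\<one>\<close> take
  every value of \<open>A\<close> at \<open>\<one>\<close>; so \<open>A\<close> is an upper section of \<open>N\<close>. Otherwise \<open>f\<close> kills \<open>N\<close> on the
  preimage of \<open>B\<close>, and \<open>B\<close> is an upper section of \<open>H\<close>. Hence it is impossible that \<open>N\<close> omits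
  some \<open>A\<close> while \<open>H\<close> omits some \<open>B\<close>.
\<close>

section \<open>The regular wreath product of two groups\<close>

text \<open>The base group consists of extensional functions, so it is finite for finite
  \<open>A\<close> and \<open>B\<close>, and functions agreeing on \<open>carrier B\<close> are
  equal. Sending \<open>q\<close> to \<open>x \<mapsto> q (x b)\<close> is a left action of
  \<open>B\<close>, which makes the multiplication associative.\<close>

definition wreath :: "('a, 'c) monoid_scheme \<Rightarrow> ('b, 'd) monoid_scheme \<Rightarrow> (('b \<Rightarrow> 'a) \<times> 'b) monoid" where
  "wreath A B =
     \<lparr>carrier = (carrier B \<rightarrow>\<^sub>E carrier A) \<times> carrier B,
      monoid.mult = (\<lambda>(p, b) (q, c).
        (\<lambda>x\<in>carrier B. p x \<otimes>\<^bsub>A\<^esub> q (x \<otimes>\<^bsub>B\<^esub> b), b \<otimes>\<^bsub>B\<^esub> c)),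
      one = (\<lambda>x\<in>carrier B. \<one>\<^bsub>A\<^esub>, \<one>\<^bsub>B\<^esub>)\<rparr>"

lemma wreath_simps:
  "carrier (wreath A B) = (carrier B \<rightarrow>\<^sub>E carrier A) \<times> carrier B"
  "(p, b) \<otimes>\<^bsub>wreath A B\<^esub> (q, c) =
     (\<lambda>x\<in>carrier B. p x \<otimes>\<^bsub>A\<^esub> q (x \<otimes>\<^bsub>B\<^esub> b), b \<otimes>\<^bsub>B\<^esub> c)"
  "\<one>\<^bsub>wreath A B\<^esub> = (\<lambda>x\<in>carrier B. \<one>\<^bsub>A\<^esub>, \<one>\<^bsub>B\<^esub>)"
  by (simp_all add: wreath_def)

lemma group_wreath:
  assumes "group A" "group B"
  shows "group (wreath A B)"
proof -
  interpret A: group A by fact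
  interpret B: group B by fact
  show ?thesis
  proof (rule groupI)
    fix u v assume "u \<in> carrier (wreath A B)" "v \<in> carrier (wreath A B)"
    then show "u \<otimes>\<^bsub>wreath A B\<^esub> v \<in> carrier (wreath A B)"
      by (cases u; cases v) (auto simp: wreath_simps PiE_mem)
  next
    show "\<one>\<^bsub>wreath A B\<^esub> \<in> carrier (wreath A B)"
      by (simp add: wreath_simps)
  next
    fix u v w assume "u \<in> carrier (wreath A B)" "v \<in> carrier (wreath A B)" "w \<in> carrier (wreath A B)"
    then obtain p b q c r d where u: "u = (p, b)" "v = (q, c)" "w = (r, d)"
      and fns: "{p, q, r} \<subseteq> carrier B \<rightarrow>\<^sub>E carrier A"
      and b: "b \<in> carrier B" "c \<in> carrier B" "d \<in> carrier B"
      by (auto simp: wreath_simps)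
    have p: "p x \<in> carrier A" "q x \<in> carrier A" "r x \<in> carrier A" if "x \<in> carrier B" for x
      using fns that by auto
    show "u \<otimes>\<^bsub>wreath A B\<^esub> v \<otimes>\<^bsub>wreath A B\<^esub> w = u \<otimes>\<^bsub>wreath A B\<^esub> (v \<otimes>\<^bsub>wreath A B\<^esub> w)"
      using b by (auto simp: u wreath_simps p A.m_assoc B.m_assoc intro!: restrict_ext)
  next
    fix u assume "u \<in> carrier (wreath A B)"
    then obtain p b where u: "u = (p, b)" "p \<in> carrier B \<rightarrow>\<^sub>E carrier A" "b \<in> carrier B"
      by (auto simp: wreath_simps)
    have p: "p x \<in> carrier A" if "x \<in> carrier B" for x
      using u(2) that by auto
    have "(\<lambda>x\<in>carrier B. (\<lambda>x\<in>carrier B. \<one>\<^bsub>A\<^esub>) x \<otimes>\<^bsub>A\<^esub> p (x \<otimes>\<^bsub>B\<^esub> \<one>\<^bsub>B\<^esub>)) = restrict p (carrier B)"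
      by (rule restrict_ext) (simp add: p)
    also have "\<dots> = p"
      using u(2) by (simp add: PiE_restrict)
    finally show "\<one>\<^bsub>wreath A B\<^esub> \<otimes>\<^bsub>wreath A B\<^esub> u = u"
      using u(3) by (simp only: u(1) wreath_simps case_prod_conv B.l_one)
    \<comment> \<open>The top component shifts \<open>p\<close> by \<open>inv b\<close>, so the base
      component has to invert \<open>p\<close> at the shifted argument.\<close>
    define v where "v = (\<lambda>x\<in>carrier B. inv\<^bsub>A\<^esub> p (x \<otimes>\<^bsub>B\<^esub> inv\<^bsub>B\<^esub> b), inv\<^bsub>B\<^esub> b)"
    have "v \<in> carrier (wreath A B)"
      using u(3) p by (simp add: v_def wreath_simps)
    moreover have "v \<otimes>\<^bsub>wreath A B\<^esub> u = \<one>\<^bsub>wreath A B\<^esub>"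
      using u(3) by (auto simp: v_def u(1) wreath_simps p intro!: restrict_ext)
    ultimately show "\<exists>v\<in>carrier (wreath A B). v \<otimes>\<^bsub>wreath A B\<^esub> u = \<one>\<^bsub>wreath A B\<^esub>"
      by blast
  qed
qed

lemma finite_wreath:
  assumes "finite (carrier A)" "finite (carrier B)"
  shows "finite (carrier (wreath A B))"
  using assms by (simp add: wreath_simps finite_PiE)

section \<open>Finite index through separating maps\<close>

text \<open>Equal values of \<open>c\<close> force equal cosets, so a coset is recovered from the
  value of \<open>c\<close> at any representative, and the finite image of \<open>c\<close> bounds
  the number of cosets.\<close>

lemma (in group) finite_rcosetsI:
  assumes K: "subgroup K G" and fin: "finite (c ` carrier G)"
    and c: "\<And>x y. \<lbrakk>x \<in> carrier G; y \<in> carrier G; c x = c y\<rbrakk> \<Longrightarrow> x \<otimes> inv y \<in> K"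
  shows "finite (rcosets K)"
proof -
  define h where "h v = K #> (SOME x. x \<in> carrier G \<and> c x = v)" for v
  have "K #> x = h (c x)" if x: "x \<in> carrier G" for x
  proof -
    define y where "y = (SOME y. y \<in> carrier G \<and> c y = c x)"
    have y: "y \<in> carrier G" "c y = c x"
      using someI[of "\<lambda>y. y \<in> carrier G \<and> c y = c x" x] x by (auto simp: y_def)
    then have "x \<in> K #> y"
      using c[of x y] x K by (metis subgroup.rcos_module_rev is_group)
    then show ?thesis
      using repr_independence[OF _ y(1) K] by (simp add: h_def y_def)
  qed
  then have "rcosets K \<subseteq> h ` c ` carrier G"
    by (auto simp: RCOSETS_def)
  then show ?thesis
    using fin finite_surj by blast
qed

text \<open>
  The map \<open>c\<close> below separates the cosets of the kernel of \<open>f\<close>. Unlike the index of a subgroup,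
  this condition restricts to subgroups of \<open>G\<close> without any computation.
\<close>

lemma (in group) upper_sectionE:
  fixes F :: "('f, 'g) monoid_scheme"
  assumes "upper_section G F" "group F" "finite (carrier F)"
  obtains K f and c :: "'a \<Rightarrow> 'a set \<times> 'f"
    where "subgroup K G" "f \<in> hom (G\<lparr>carrier := K\<rparr>) F" "f ` K = carrier F"
    "finite (c ` carrier G)"
    "\<And>x y. \<lbrakk>x \<in> carrier G; y \<in> carrier G; c x = c y\<rbrakk>
       \<Longrightarrow> x \<otimes> inv y \<in> K \<and> f (x \<otimes> inv y) = \<one>\<^bsub>F\<^esub>"
proof -
  interpret F: group F by fact
  obtain K f where K: "subgroup K G" "finite (rcosets K)"
    and f: "f \<in> hom (G\<lparr>carrier := K\<rparr>) F" "f ` K = carrier F"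
    using assms(1) by (auto simp: upper_section_def epi_def)
  interpret K: subgroup K G by fact
  interpret f: group_hom "G\<lparr>carrier := K\<rparr>" F f
    using f(1) K(1) by (simp add: group_hom_def group_hom_axioms_def subgroup_imp_group)
  define r where "r C = (SOME y. y \<in> C)" for C :: "'a set"
  have r: "r (K #> x) \<in> carrier G" "x \<otimes> inv r (K #> x) \<in> K" if x: "x \<in> carrier G" for x
  proof -
    have rx: "r (K #> x) \<in> K #> x"
      unfolding r_def using x K(1) by (metis rcos_self someI)
    show rG: "r (K #> x) \<in> carrier G"
      using rx x K.subset r_coset_subset_G by blast
    have "x \<in> K #> r (K #> x)"
      using repr_independence[OF rx x K(1)] rcos_self[OF x K(1)] by simp
    then show "x \<otimes> inv r (K #> x) \<in> K"
      using x rG by (metis K.rcos_module_imp is_group)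
  qed
  \<comment> \<open>The coset alone separates only modulo \<open>K\<close>. The second entry adds
    the image of the displacement of \<open>x\<close> from the chosen representative, which lies in
    the finite \<open>carrier F\<close>.\<close>
  define c where "c x = (K #> x, f (x \<otimes> inv r (K #> x)))" for x
  have "c ` carrier G \<subseteq> (rcosets K) \<times> carrier F"
    using r f(2) by (auto simp: c_def RCOSETS_def)
  then have fin: "finite (c ` carrier G)"
    using K(2) assms(3) finite_subset by blast
  have sep: "x \<otimes> inv y \<in> K \<and> f (x \<otimes> inv y) = \<one>\<^bsub>F\<^esub>"
    if xy: "x \<in> carrier G" "y \<in> carrier G" "c x = c y" for x y
  proof -
    define z where "z = r (K #> x)"
    have "K #> x = K #> y" and fxy: "f (x \<otimes> inv r (K #> x)) = f (y \<otimes> inv r (K #> y))"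
      using xy(3) unfolding c_def prod.inject by blast+
    then have zy: "r (K #> y) = z"
      by (simp add: z_def)
    have z: "z \<in> carrier G" "x \<otimes> inv z \<in> K" "y \<otimes> inv z \<in> K" "f (x \<otimes> inv z) = f (y \<otimes> inv z)"
      using r[OF xy(1)] r[OF xy(2)] fxy unfolding zy z_def[symmetric] by auto
    \<comment> \<open>Both displacements start from the same representative \<open>z\<close> and
      have equal images, so their quotient lies in the kernel.\<close>
    have "x \<otimes> inv y = (x \<otimes> inv z) \<otimes> inv (y \<otimes> inv z)"
      using xy z(1) by (simp add: inv_mult_group m_assoc[symmetric])
         (simp add: m_assoc)
    moreover have "f ((x \<otimes> inv z) \<otimes> inv (y \<otimes> inv z)) = f (x \<otimes> inv z) \<otimes>\<^bsub>F\<^esub> inv\<^bsub>F\<^esub> f (y \<otimes> inv z)"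
      using f.hom_mult[of "x \<otimes> inv z" "inv (y \<otimes> inv z)"] f.hom_inv[of "y \<otimes> inv z"] z K(1)
      by (simp add: m_inv_consistent)
    ultimately show ?thesis
      using z f.hom_closed by auto
  qed
  show thesis
    using sep by (intro that[OF K(1) f fin]) auto
qed

text \<open>The image of \<open>N\<close> under \<open>c\<close> is still finite, so separation on
  \<open>N\<close> bounds the index of \<open>P\<close> in \<open>N\<close>.\<close>

lemma (in group) upper_section_subgroupI:
  assumes N: "subgroup N G" and P: "subgroup P G" "P \<subseteq> N"
    and g: "g \<in> hom (G\<lparr>carrier := P\<rparr>) F" "g ` P = carrier F"
    and fin: "finite (c ` carrier G)"
    and c: "\<And>x y. \<lbrakk>x \<in> N; y \<in> N; c x = c y\<rbrakk> \<Longrightarrow> x \<otimes> inv y \<in> P"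
  shows "upper_section (G\<lparr>carrier := N\<rparr>) F"
proof -
  interpret N: group "G\<lparr>carrier := N\<rparr>"
    using N by (rule subgroup_imp_group)
  have sub: "subgroup P (G\<lparr>carrier := N\<rparr>)"
    using N P subgroup_incl by blast
  have "finite (c ` N)"
    using fin subgroup.subset[OF N] by (meson finite_subset image_mono)
  then have "finite (rcosets\<^bsub>G\<lparr>carrier := N\<rparr>\<^esub> P)"
    using N.finite_rcosetsI[OF sub, of c] c N by (simp add: m_inv_consistent)
  moreover have "g \<in> epi (G\<lparr>carrier := N, carrier := P\<rparr>) F"
    using g by (simp add: epi_def)
  ultimately show ?thesis
    using sub by (auto simp: upper_section_def)
qed

section \<open>The dichotomy for a wreath product\<close>

text \<open>Fixing one pair \<open>A\<close>, \<open>B\<close> lets a single wreath product deal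
  with a group missing from \<open>N\<close> and a group missing from \<open>H\<close> at the same
  time.\<close>

lemma (in group) upper_section_normal_or_complement:
  fixes A :: "('e, 'g) monoid_scheme" and B :: "('f, 'h) monoid_scheme"
  assumes N: "N \<lhd> G" and H: "subgroup H G" and NH: "N <#> H = carrier G"
    and A: "group A" and fA: "finite (carrier A)" and B: "group B" and fB: "finite (carrier B)"
    and W: "upper_section G (wreath A B)"
  shows "upper_section (G\<lparr>carrier := N\<rparr>) A \<or> upper_section (G\<lparr>carrier := H\<rparr>) B"
proof -
  interpret A: group A by fact
  interpret B: group B by fact
  interpret N: normal N G by fact
  interpret H: subgroup H G by fact
  let ?W = "wreath A B"
  interpret W: group ?W using A B by (rule group_wreath)
  \<comment> \<open>The identity of the base group; the top group is the set of pairs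
    \<open>(e, b)\<close>.\<close>
  define e where "e = (\<lambda>x\<in>carrier B. \<one>\<^bsub>A\<^esub>)"
  have e: "e \<in> carrier B \<rightarrow>\<^sub>E carrier A"
    by (simp add: e_def)
  have oneW: "\<one>\<^bsub>?W\<^esub> = (e, \<one>\<^bsub>B\<^esub>)"
    by (simp add: wreath_simps e_def)
  have topW: "(e, b) \<otimes>\<^bsub>?W\<^esub> (e, b') = (e, b \<otimes>\<^bsub>B\<^esub> b')" if "b \<in> carrier B" "b' \<in> carrier B" for b b'
    using that by (auto simp: wreath_simps e_def intro!: restrict_ext)
  have invtop: "inv\<^bsub>?W\<^esub> (e, b) = (e, inv\<^bsub>B\<^esub> b)" if "b \<in> carrier B" for b
    using that by (intro W.inv_equality) (auto simp: topW oneW, auto simp: wreath_simps e_def)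
  have snd_mult: "snd (u \<otimes>\<^bsub>?W\<^esub> v) = snd u \<otimes>\<^bsub>B\<^esub> snd v" for u v
    by (cases u; cases v) (simp add: wreath_simps)
  obtain K f and c :: "'a \<Rightarrow> 'a set \<times> ('f \<Rightarrow> 'e) \<times> 'f"
    where K: "subgroup K G" and f: "f \<in> hom (G\<lparr>carrier := K\<rparr>) ?W" "f ` K = carrier ?W"
    and fin: "finite (c ` carrier G)"
    and c: "\<And>x y. \<lbrakk>x \<in> carrier G; y \<in> carrier G; c x = c y\<rbrakk>
      \<Longrightarrow> x \<otimes> inv y \<in> K \<and> f (x \<otimes> inv y) = \<one>\<^bsub>?W\<^esub>"
    by (rule upper_sectionE[OF W W.is_group finite_wreath[OF fA fB]]) (rule that)
  interpret K: subgroup K G by fact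
  interpret f: group_hom "G\<lparr>carrier := K\<rparr>" ?W f
    using f(1) K by (simp add: group_hom_def group_hom_axioms_def subgroup_imp_group)
  have f_mult: "f (x \<otimes> y) = f x \<otimes>\<^bsub>?W\<^esub> f y" if "x \<in> K" "y \<in> K" for x y
    using f.hom_mult that by simp
  have f_inv: "f (inv x) = inv\<^bsub>?W\<^esub> f x" if "x \<in> K" for x
    using f.hom_inv that K by (simp add: m_inv_consistent)
  have f_one: "f \<one> = \<one>\<^bsub>?W\<^esub>"
    using f.hom_one by simp
  have f_closed: "f x \<in> carrier ?W" if "x \<in> K" for x
    using f.hom_closed that by simp
  show ?thesis
  proof (cases "\<exists>n\<in>K \<inter> N. \<exists>b. f n = (e, b) \<and> b \<noteq> \<one>\<^bsub>B\<^esub>")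
    case True
    then obtain n b where n: "n \<in> K" "n \<in> N" "f n = (e, b)" "b \<noteq> \<one>\<^bsub>B\<^esub>"
      by blast
    have b: "b \<in> carrier B"
      using f_closed[OF n(1)] n(3) by (simp add: wreath_simps)
    \<comment> \<open>\<open>P\<close> is the part of \<open>K \<inter> N\<close> that
      \<open>f\<close> maps into the base group. There no shift occurs in products, so evaluation at
      the identity of \<open>B\<close> is a homomorphism.\<close>
    define P where "P = {k \<in> K \<inter> N. snd (f k) = \<one>\<^bsub>B\<^esub>}"
    define g where "g k = fst (f k) \<one>\<^bsub>B\<^esub>" for k
    have snd_inv: "snd (f (inv x)) = \<one>\<^bsub>B\<^esub>" if x: "x \<in> K" "snd (f x) = \<one>\<^bsub>B\<^esub>" for x
    proof -
      have "snd (f (inv x)) \<in> carrier B"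
        using f_closed[of "inv x"] x(1) by (auto simp: wreath_simps)
      moreover have "snd (f x) \<otimes>\<^bsub>B\<^esub> snd (f (inv x)) = snd (f (x \<otimes> inv x))"
        using x(1) by (simp only: f_mult K.m_inv_closed snd_mult)
      ultimately show ?thesis
        using x by (simp add: f_one oneW)
    qed
    have P: "subgroup P G"
      by (rule subgroupI) (auto simp: P_def f_mult f_one snd_mult snd_inv oneW intro!: exI[of _ \<one>])
    have g_hom: "g \<in> hom (G\<lparr>carrier := P\<rparr>) A"
    proof (rule homI)
      fix x assume "x \<in> carrier (G\<lparr>carrier := P\<rparr>)"
      then show "g x \<in> carrier A"
        using f_closed[of x] by (auto simp: P_def g_def wreath_simps PiE_mem)
    next
      fix x y assume "x \<in> carrier (G\<lparr>carrier := P\<rparr>)" "y \<in> carrier (G\<lparr>carrier := P\<rparr>)"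
      then show "g (x \<otimes>\<^bsub>G\<lparr>carrier := P\<rparr>\<^esub> y) = g x \<otimes>\<^bsub>A\<^esub> g y"
        by (cases "f x"; cases "f y") (simp add: P_def g_def f_mult wreath_simps)
    qed
    have "a \<in> g ` P" if a: "a \<in> carrier A" for a
    proof -
      \<comment> \<open>The commutator of \<open>(e, b)\<close> with \<open>(d, \<one>)\<close> has
        base component \<open>x \<mapsto> d (x b) d' (x)\<close>. At the identity the first factor
        is trivial because \<open>b\<close> is not the identity, and the second is
        \<open>a\<close>.\<close>
      define d where "d = (\<lambda>x\<in>carrier B. if x = \<one>\<^bsub>B\<^esub> then inv\<^bsub>A\<^esub> a else \<one>\<^bsub>A\<^esub>)"
      define d' where "d' = (\<lambda>x\<in>carrier B. if x = \<one>\<^bsub>B\<^esub> then a else \<one>\<^bsub>A\<^esub>)"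
      have dW: "(d, \<one>\<^bsub>B\<^esub>) \<in> carrier ?W" "(d', \<one>\<^bsub>B\<^esub>) \<in> carrier ?W"
        using a by (auto simp: wreath_simps d_def d'_def)
      have "(d', \<one>\<^bsub>B\<^esub>) \<otimes>\<^bsub>?W\<^esub> (d, \<one>\<^bsub>B\<^esub>) = \<one>\<^bsub>?W\<^esub>"
        using a by (auto simp: wreath_simps d_def d'_def intro!: restrict_ext)
      then have dinv: "inv\<^bsub>?W\<^esub> (d, \<one>\<^bsub>B\<^esub>) = (d', \<one>\<^bsub>B\<^esub>)"
        using dW by (intro W.inv_equality)
      obtain k where k: "k \<in> K" "f k = (d, \<one>\<^bsub>B\<^esub>)"
        using dW f(2) by (metis imageE)
      \<comment> \<open>The commutator of \<open>n\<close> and \<open>k\<close>, bracketed to show a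
        conjugate of \<open>inv n\<close>, which normality keeps in \<open>N\<close>.\<close>
      define m where "m = n \<otimes> (k \<otimes> inv n \<otimes> inv k)"
      have m: "m \<in> K" "m \<in> N"
        using n k by (simp_all add: m_def N.inv_op_closed2)
      have "f m = (e, b) \<otimes>\<^bsub>?W\<^esub> ((d, \<one>\<^bsub>B\<^esub>) \<otimes>\<^bsub>?W\<^esub> (e, inv\<^bsub>B\<^esub> b) \<otimes>\<^bsub>?W\<^esub> (d', \<one>\<^bsub>B\<^esub>))"
        using n k b by (simp add: m_def f_mult f_inv invtop dinv)
      then have "g m = a \<and> snd (f m) = \<one>\<^bsub>B\<^esub>"
        using a b n(4) by (simp add: g_def wreath_simps e_def d_def d'_def)
      then show ?thesis
        using m by (auto simp: P_def)
    qed
    then have "g ` P = carrier A"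
      using g_hom by (auto simp: hom_def)
    moreover have "x \<otimes> inv y \<in> P" if "x \<in> N" "y \<in> N" "c x = c y" for x y
      using c[of x y] that by (simp add: P_def oneW)
    ultimately have "upper_section (G\<lparr>carrier := N\<rparr>) A"
      using upper_section_subgroupI[OF N.subgroup_axioms P _ g_hom _ fin] by (auto simp: P_def)
    then show ?thesis ..
  next
    case False
    \<comment> \<open>The preimage of the top group.\<close>
    define L where "L = {k \<in> K. fst (f k) = e}"
    have L_f: "f k = (e, snd (f k))" "snd (f k) \<in> carrier B" if "k \<in> L" for k
      using that f_closed[of k] by (auto simp: L_def wreath_simps prod_eq_iff)
    have L: "subgroup L G"
    proof (rule subgroupI)
      show "L \<noteq> {}"
        using f_one oneW by (auto simp: L_def intro!: exI[of _ \<one>])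
      show "inv x \<in> L" if "x \<in> L" for x
        using L_f[OF that] that f_inv[of x] invtop[of "snd (f x)"] by (auto simp: L_def)
      show "x \<otimes> y \<in> L" if "x \<in> L" "y \<in> L" for x y
        using L_f[OF that(1)] L_f[OF that(2)] that f_mult[of x y] topW[of "snd (f x)" "snd (f y)"]
        by (auto simp: L_def)
    qed (auto simp: L_def)
    interpret L: subgroup L G by fact
    have snd_mult_L: "snd (f (x \<otimes> y)) = snd (f x) \<otimes>\<^bsub>B\<^esub> snd (f y)" if "x \<in> L" "y \<in> L" for x y
      using that by (simp add: L_def f_mult snd_mult)
    \<comment> \<open>The case assumption enters here: no element of \<open>K \<inter> N\<close> has
      a nontrivial image in the top group.\<close>
    have kill: "snd (f n) = \<one>\<^bsub>B\<^esub>" if "n \<in> L" "n \<in> N" for n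
      using False that L_f(1)[of n] by (auto simp: L_def)
    \<comment> \<open>\<open>Q\<close> is the projection of \<open>L\<close> to \<open>H\<close>
      along \<open>N\<close>. The map on \<open>L\<close> descends to \<open>Q\<close> by choosing
      any lift \<open>n \<otimes> h\<close> in \<open>L\<close>.\<close>
    define Q where "Q = {h \<in> H. \<exists>n\<in>N. n \<otimes> h \<in> L}"
    define s where "s h = (SOME n. n \<in> N \<and> n \<otimes> h \<in> L)" for h
    define g where "g h = snd (f (s h \<otimes> h))" for h
    \<comment> \<open>Two lifts of \<open>h\<close> differ by the left factor
      \<open>s h \<otimes> inv n\<close>, which lies in \<open>L \<inter> N\<close> and is therefore
      killed.\<close>
    have g: "g h = snd (f (n \<otimes> h))" if h: "h \<in> H" "n \<in> N" "n \<otimes> h \<in> L" for n h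
    proof -
      have s: "s h \<in> N" "s h \<otimes> h \<in> L"
        using someI[of "\<lambda>n. n \<in> N \<and> n \<otimes> h \<in> L" n] h by (auto simp: s_def)
      have eq: "(s h \<otimes> inv n) \<otimes> (n \<otimes> h) = s h \<otimes> h"
        using s h by (simp add: m_assoc[symmetric]) (simp add: m_assoc)
      have "s h \<otimes> inv n = (s h \<otimes> h) \<otimes> inv (n \<otimes> h)"
        using s h by (simp add: inv_mult_group m_assoc[symmetric]) (simp add: m_assoc)
      then have "s h \<otimes> inv n \<in> L"
        using s h by simp
      then show ?thesis
        using snd_mult_L[of "s h \<otimes> inv n" "n \<otimes> h"] kill[of "s h \<otimes> inv n"] s h L_f(2)[of "n \<otimes> h"]
        by (simp add: eq g_def)
    qed
    \<comment> \<open>Moving \<open>h\<close> past \<open>n'\<close> by conjugation shows that a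
      product of lifts of \<open>h\<close> and \<open>h'\<close> is a lift of
      \<open>h \<otimes> h'\<close>.\<close>
    have mult: "h \<otimes> n' \<otimes> inv h \<in> N" "(n \<otimes> (h \<otimes> n' \<otimes> inv h)) \<otimes> (h \<otimes> h') = (n \<otimes> h) \<otimes> (n' \<otimes> h')"
      if "n \<in> N" "n' \<in> N" "h \<in> H" "h' \<in> H" for n n' h h'
    proof -
      show "h \<otimes> n' \<otimes> inv h \<in> N"
        using that by (simp add: N.inv_op_closed2)
      have "inv h \<otimes> (h \<otimes> h') = h'"
        using that by (simp add: m_assoc[symmetric])
      then show "(n \<otimes> (h \<otimes> n' \<otimes> inv h)) \<otimes> (h \<otimes> h') = (n \<otimes> h) \<otimes> (n' \<otimes> h')"
        using that by (simp add: m_assoc)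
    qed
    have Q: "subgroup Q G"
    proof (rule subgroupI)
      show "Q \<noteq> {}"
        by (auto simp: Q_def intro!: exI[of _ \<one>] bexI[of _ \<one>])
    next
      fix h assume "h \<in> Q"
      then obtain n where h: "h \<in> H" "n \<in> N" "n \<otimes> h \<in> L"
        by (auto simp: Q_def)
      then have "inv (n \<otimes> h) = (inv h \<otimes> inv n \<otimes> h) \<otimes> inv h"
        by (simp add: inv_mult_group m_assoc)
      moreover have "inv h \<otimes> inv n \<otimes> h \<in> N"
        using h by (simp add: N.inv_op_closed1)
      ultimately show "inv h \<in> Q"
        using h L.m_inv_closed[of "n \<otimes> h"] by (auto simp: Q_def)
    next
      fix h h' assume "h \<in> Q" "h' \<in> Q"
      then obtain n n' where "h \<in> H" "n \<in> N" "n \<otimes> h \<in> L" "h' \<in> H" "n' \<in> N" "n' \<otimes> h' \<in> L"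
        by (auto simp: Q_def)
      then show "h \<otimes> h' \<in> Q"
        using mult[of n n' h h'] L.m_closed[of "n \<otimes> h" "n' \<otimes> h'"] unfolding Q_def
        by (metis (mono_tags, lifting) H.m_closed N.m_closed mem_Collect_eq)
    qed (auto simp: Q_def)
    have g_hom: "g \<in> hom (G\<lparr>carrier := Q\<rparr>) B"
    proof (rule homI)
      fix h assume "h \<in> carrier (G\<lparr>carrier := Q\<rparr>)"
      then show "g h \<in> carrier B"
        using g L_f(2) by (auto simp: Q_def)
    next
      fix h h' assume "h \<in> carrier (G\<lparr>carrier := Q\<rparr>)" "h' \<in> carrier (G\<lparr>carrier := Q\<rparr>)"
      then obtain n n' where h: "h \<in> H" "n \<in> N" "n \<otimes> h \<in> L" "h' \<in> H" "n' \<in> N" "n' \<otimes> h' \<in> L"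
        by (auto simp: Q_def)
      have "g (h \<otimes> h') = snd (f ((n \<otimes> h) \<otimes> (n' \<otimes> h')))"
        using g[of "h \<otimes> h'" "n \<otimes> (h \<otimes> n' \<otimes> inv h)"] mult[of n n' h h'] h by simp
      also have "\<dots> = g h \<otimes>\<^bsub>B\<^esub> g h'"
        using h by (simp add: snd_mult_L g)
      finally show "g (h \<otimes>\<^bsub>G\<lparr>carrier := Q\<rparr>\<^esub> h') = g h \<otimes>\<^bsub>B\<^esub> g h'"
        by simp
    qed
    have "b \<in> g ` Q" if b: "b \<in> carrier B" for b
    proof -
      have "(e, b) \<in> f ` K"
        using b e by (simp add: f(2) wreath_simps)
      then obtain k where k: "k \<in> K" "f k = (e, b)"
        by auto
      then obtain n h where "n \<in> N" "h \<in> H" "k = n \<otimes> h"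
        using NH K.mem_carrier[OF k(1)] unfolding set_mult_def by blast
      then show ?thesis
        using k g[of h n] by (force simp: Q_def L_def)
    qed
    then have "g ` Q = carrier B"
      using g_hom by (auto simp: hom_def)
    \<comment> \<open>An element of \<open>H\<close> in the kernel of \<open>f\<close> lies in
      \<open>L\<close>, so it lifts itself with \<open>N\<close>-component
      \<open>\<one>\<close>.\<close>
    moreover have "x \<otimes> inv y \<in> Q" if "x \<in> H" "y \<in> H" "c x = c y" for x y
      using c[of x y] that by (auto simp: Q_def L_def oneW intro!: bexI[of _ \<one>])
    ultimately have "upper_section (G\<lparr>carrier := H\<rparr>) B"
      using upper_section_subgroupI[OF H Q _ g_hom _ fin] by (auto simp: Q_def)
    then show ?thesis ..
  qed
qed

theorem theorem3p4:
  fixes G :: "('a, 'c) monoid_scheme" and N H :: "'a set"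
  assumes "group G"
    and "semidirect_product G N H"
    and "every_finite_upper_section G"
  shows "every_finite_upper_section (G\<lparr>carrier := N\<rparr>)
       \<or> every_finite_upper_section (G\<lparr>carrier := H\<rparr>)"
proof (rule ccontr)
  interpret group G by fact
  assume "\<not> ?thesis"
  then obtain A B :: "nat monoid" where A: "group A" "finite (carrier A)"
    and B: "group B" "finite (carrier B)"
    and not: "\<not> upper_section (G\<lparr>carrier := N\<rparr>) A" "\<not> upper_section (G\<lparr>carrier := H\<rparr>) B"
    unfolding every_finite_upper_section_def by blast
  \<comment> \<open>The elements of the wreath product are pairs rather than natural numbers, hence
    the passage to finite groups of arbitrary type.\<close>
  have "upper_section G (wreath A B)"
    using assms(3) group_wreath finite_wreath A B by (intro every_finite_upper_sectionD) auto
  then show False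
    using upper_section_normal_or_complement[of N H A B] assms(2) A B not
    by (simp add: semidirect_product_def)
qed

end
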